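(* Let $\xi_1=(\mathcal{E}_1,p_1,T)$ be a full Banach bundle, $\xi_2=(\mathcal{E}_2,p_2,T)$ a Banach bundle, and $\varphi$ a Banach bundle map from $\xi_1$ to $\xi_2$ with $\varphi(\mathcal{E}_1)=\mathcal{E}_2$. Then $\varphi$ is an open map if and only if there exist an open cover $\{V_\alpha\}_{\alpha\in\mathcal{A}}$ of $T$ and positive numbers $\{m_\alpha\}_{\alpha\in\mathcal{A}}$ such that for every $\alpha\in\mathcal{A}$ and every $y\in p_2^{-1}(V_\alpha)$ there is $x\in\mathcal{E}_1$ that satisfies $\varphi(x)=y$ and $\|x\|\leq m_\alpha\|y\|$.
   Context: $\mathbb{K}$ is the real or the complex field. A Banach bundle $\xi=(\mathcal{E},p,T)$ consists of a Hausdorff space $T$ (base space), a topological space $\mathcal{E}$ (bundle space, not assumed Hausdorff), and a continuous open surjection $p:\mathcal{E}\to T$ such that each fiber $\mathcal{E}(t)=p^{-1}(t)$ is a Banach space over $\mathbb{K}$ with origin $0_t$, and: addition $\{(x,y)\in\mathcal{E}\times\mathcal{E}: p(x)=p(y)\}\to\mathcal{E}$ and scalar multiplication $\mathbb{K}\times\mathcal{E}\to\mathcal{E}$ are continuous; $x\mapsto\|x\|$ is upper semi-continuous on $\mathcal{E}$; and if $(x_\iota)$ is a net in $\mathcal{E}$ with $p(x_\iota)\to t$ and $\|x_\iota\|\to 0$, then $x_\iota\to 0_t$. A section of $\xi$ is a continuous $f:T\to\mathcal{E}$ with $p(f(t))=t$ for all $t\in T$. The bundle $\xi$ is full if for each $x\in\mathcal{E}$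 there is a section $f$ of $\xi$ with $f(p(x))=x$. A Banach bundle map from $\xi_1$ to $\xi_2$ is a continuous map $\varphi:\mathcal{E}_1\to\mathcal{E}_2$ with $\varphi(p_1^{-1}(t))\subset p_2^{-1}(t)$ for every $t\in T$ whose restriction to each fiber is linear. *)

theory Defs
  imports "HOL-Analysis.Analysis"
begin

text \<open>
  The scalar field is a type of class \<open>real_normed_field\<close>. Up to isometric isomorphism the
  only such fields are the real and the complex numbers (Gelfand--Mazur), so a statement about
  an arbitrary \<open>'k :: real_normed_field\<close> is a statement about both.
\<close>

text \<open>
  In \<open>complete\<close> the norm distance is set to 0 off \<open>S\<close>: the library locale
  \<open>Metric_space\<close> requires nonnegativity and symmetry on the whole type.
\<close>

locale banach_space_on =
  fixes S :: "'e set"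
    and add :: "'e \<Rightarrow> 'e \<Rightarrow> 'e"
    and scale :: "'k::real_normed_field \<Rightarrow> 'e \<Rightarrow> 'e"
    and zero :: 'e
    and nrm :: "'e \<Rightarrow> real"
  assumes zero_in: "zero \<in> S"
    and add_in: "\<lbrakk>x \<in> S; y \<in> S\<rbrakk> \<Longrightarrow> add x y \<in> S"
    and scale_in: "x \<in> S \<Longrightarrow> scale c x \<in> S"
    and add_assoc: "\<lbrakk>x \<in> S; y \<in> S; z \<in> S\<rbrakk> \<Longrightarrow> add (add x y) z = add x (add y z)"
    and add_commute: "\<lbrakk>x \<in> S; y \<in> S\<rbrakk> \<Longrightarrow> add x y = add y x"
    and add_zero: "x \<in> S \<Longrightarrow> add x zero = x"
    and add_inverse: "x \<in> S \<Longrightarrow> add x (scale (- 1) x) = zero"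
    and scale_add_right: "\<lbrakk>x \<in> S; y \<in> S\<rbrakk> \<Longrightarrow> scale c (add x y) = add (scale c x) (scale c y)"
    and scale_add_left: "x \<in> S \<Longrightarrow> scale (c + d) x = add (scale c x) (scale d x)"
    and scale_scale: "x \<in> S \<Longrightarrow> scale c (scale d x) = scale (c * d) x"
    and scale_one: "x \<in> S \<Longrightarrow> scale 1 x = x"
    and norm_nonneg: "x \<in> S \<Longrightarrow> 0 \<le> nrm x"
    and norm_eq_0: "x \<in> S \<Longrightarrow> nrm x = 0 \<longleftrightarrow> x = zero"
    and norm_scale: "x \<in> S \<Longrightarrow> nrm (scale c x) = norm c * nrm x"
    and norm_triangle: "\<lbrakk>x \<in> S; y \<in> S\<rbrakk> \<Longrightarrow> nrm (add x y) \<le> nrm x + nrm y"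
    and complete: "Metric_space.mcomplete S
                     (\<lambda>x y. if x \<in> S \<and> y \<in> S then nrm (add x (scale (- 1) y)) else 0)"

text \<open>
  The fibrewise operations of all fibres are bundled into single functions on the bundle space;
  \<open>vadd\<close> is only meaningful on pairs of points over the same base point.
\<close>

record ('k, 'e, 't) bundle_data =
  bundle_space :: "'e topology"
  proj :: "'e \<Rightarrow> 't"
  base :: "'t topology"
  vadd :: "'e \<Rightarrow> 'e \<Rightarrow> 'e"
  vscale :: "'k \<Rightarrow> 'e \<Rightarrow> 'e"
  vzero :: "'t \<Rightarrow> 'e"
  vnorm :: "'e \<Rightarrow> real"

definition fiber :: "('k, 'e, 't) bundle_data \<Rightarrow> 't \<Rightarrow> 'e set" where
  "fiber \<xi> t = {x \<in> topspace (bundle_space \<xi>). proj \<xi> x = t}"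

definition fiber_product :: "('k, 'e, 't) bundle_data \<Rightarrow> ('e \<times> 'e) topology" where
  "fiber_product \<xi> =
     subtopology (prod_topology (bundle_space \<xi>) (bundle_space \<xi>)) {(x, y). proj \<xi> x = proj \<xi> y}"

definition upper_semicontinuous :: "'e topology \<Rightarrow> ('e \<Rightarrow> real) \<Rightarrow> bool" where
  "upper_semicontinuous X f \<longleftrightarrow> (\<forall>a. openin X {x \<in> topspace X. f x < a})"

text \<open>
  In \<open>small_norm_tendsto\<close> nets are represented by filters on the bundle space: a net
  corresponds to the filter of all sets in which it eventually lies, and every filter
  arises in this way.
\<close>

locale banach_bundle =
  fixes \<xi> :: "('k::real_normed_field, 'e, 't) bundle_data"
  assumes base_Hausdorff: "Hausdorff_space (base \<xi>)"
    and proj_continuous: "continuous_map (bundle_space \<xi>) (base \<xi>) (proj \<xi>)"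
    and proj_open: "open_map (bundle_space \<xi>) (base \<xi>) (proj \<xi>)"
    and proj_surj: "proj \<xi> ` topspace (bundle_space \<xi>) = topspace (base \<xi>)"
    and fiber_banach: "t \<in> topspace (base \<xi>) \<Longrightarrow>
          banach_space_on (fiber \<xi> t) (vadd \<xi>) (vscale \<xi>) (vzero \<xi> t) (vnorm \<xi>)"
    and add_continuous: "continuous_map (fiber_product \<xi>) (bundle_space \<xi>) (\<lambda>(x, y). vadd \<xi> x y)"
    and scale_continuous:
          "continuous_map (prod_topology euclidean (bundle_space \<xi>)) (bundle_space \<xi>) (\<lambda>(c, x). vscale \<xi> c x)"
    and norm_usc: "upper_semicontinuous (bundle_space \<xi>) (vnorm \<xi>)"
    and small_norm_tendsto: "\<And>F t. \<lbrakk>\<forall>\<^sub>F x in F. x \<in> topspace (bundle_space \<xi>);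
            limitin (base \<xi>) (proj \<xi>) t F; (vnorm \<xi> \<longlongrightarrow> 0) F\<rbrakk>
          \<Longrightarrow> limitin (bundle_space \<xi>) (\<lambda>x. x) (vzero \<xi> t) F"

definition bundle_section :: "('k, 'e, 't) bundle_data \<Rightarrow> ('t \<Rightarrow> 'e) \<Rightarrow> bool" where
  "bundle_section \<xi> f \<longleftrightarrow> continuous_map (base \<xi>) (bundle_space \<xi>) f \<and>
     (\<forall>t \<in> topspace (base \<xi>). proj \<xi> (f t) = t)"

definition full_bundle :: "('k, 'e, 't) bundle_data \<Rightarrow> bool" where
  "full_bundle \<xi> \<longleftrightarrow>
     (\<forall>x \<in> topspace (bundle_space \<xi>). \<exists>f. bundle_section \<xi> f \<and> f (proj \<xi> x) = x)"

definition banach_bundle_map ::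
    "('k, 'e, 't) bundle_data \<Rightarrow> ('k, 'f, 't) bundle_data \<Rightarrow> ('e \<Rightarrow> 'f) \<Rightarrow> bool" where
  "banach_bundle_map \<xi> \<eta> \<phi> \<longleftrightarrow>
     continuous_map (bundle_space \<xi>) (bundle_space \<eta>) \<phi> \<and>
     (\<forall>t \<in> topspace (base \<xi>).
        \<phi> ` fiber \<xi> t \<subseteq> fiber \<eta> t \<and>
        (\<forall>x \<in> fiber \<xi> t. \<forall>y \<in> fiber \<xi> t. \<phi> (vadd \<xi> x y) = vadd \<eta> (\<phi> x) (\<phi> y)) \<and>
        (\<forall>c. \<forall>x \<in> fiber \<xi> t. \<phi> (vscale \<xi> c x) = vscale \<eta> c (\<phi> x)))"

definition open_cover :: "'t topology \<Rightarrow> 'i set \<Rightarrow> ('i \<Rightarrow> 't set) \<Rightarrow> bool" where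
  "open_cover X A V \<longleftrightarrow> (\<forall>\<alpha> \<in> A. openin X (V \<alpha>)) \<and> (\<Union>\<alpha>\<in>A. V \<alpha>) = topspace X"

text \<open>
  HOL cannot quantify existentially over the type of indices of a cover. The next lemma shows
  that index sets of type \<open>'t set set\<close> suffice, even if the members of the cover
  carry additional data.
\<close>

lemma open_cover_reindex:
  fixes A :: "'i set" and V :: "'i \<Rightarrow> 't set" and m :: "'i \<Rightarrow> real"
  assumes "open_cover X A V" and "\<forall>\<alpha> \<in> A. P (V \<alpha>) (m \<alpha>)"
  shows "\<exists>(B :: 't set set) W n. open_cover X B W \<and> (\<forall>\<beta> \<in> B. P (W \<beta>) (n \<beta>))"
proof -
  define g where "g = inv_into A V"
  have g: "g U \<in> A" "V (g U) = U" if "U \<in> V ` A" for U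
    using that by (auto simp: g_def inv_into_into f_inv_into_f)
  have "open_cover X (V ` A) (\<lambda>U. U)"
    using assms(1) by (auto simp: open_cover_def)
  moreover have "\<forall>U \<in> V ` A. P U (m (g U))"
    using g assms(2) by metis
  ultimately show ?thesis
    by (intro exI[of _ "V ` A"] exI[of _ "\<lambda>U. U"] exI[of _ "\<lambda>U. m (g U)"] conjI)
qed

end

theory Submission
  imports Defs
begin

text \<open>
  Near the origin of a fibre, the sets of all \<open>x\<close> with \<open>p x \<in> V\<close> and \<open>\<parallel>x\<parallel> < e\<close> form a basis of
  neighbourhoods. If \<open>\<phi>\<close> is open, the image of the open unit ball bundle therefore contains such
  a tube, and homogeneity turns this into a uniform bound over \<open>V\<close>. Conversely, translate by a
  section \<open>f\<close> through a given point \<open>x\<^sub>0\<close>, and by \<open>- \<phi> \<circ> f\<close> downstairs: translations are continuous,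
  so openness of \<open>\<phi>\<close> at \<open>x\<^sub>0\<close> is reduced to openness at the origin, where the bounds give it.
\<close>

section \<open>Fibres and neighbourhoods of their origins\<close>

lemma (in banach_space_on) scale_zero_left: "x \<in> S \<Longrightarrow> scale 0 x = zero"
  using norm_eq_0[of "scale 0 x"] norm_scale[of x 0] scale_in[of x 0] by simp

context banach_bundle
begin

lemma proj_in: "x \<in> topspace (bundle_space \<xi>) \<Longrightarrow> proj \<xi> x \<in> topspace (base \<xi>)"
  using proj_surj by blast

lemma fiber_proj: "x \<in> topspace (bundle_space \<xi>) \<Longrightarrow> x \<in> fiber \<xi> (proj \<xi> x)"
  by (simp add: fiber_def)

lemma fiber_banach_proj:
  "x \<in> topspace (bundle_space \<xi>) \<Longrightarrow>
     banach_space_on (fiber \<xi> (proj \<xi> x)) (vadd \<xi>) (vscale \<xi>) (vzero \<xi> (proj \<xi> x)) (vnorm \<xi>)"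
  by (intro fiber_banach proj_in)

lemma vnorm_nonneg: "x \<in> topspace (bundle_space \<xi>) \<Longrightarrow> 0 \<le> vnorm \<xi> x"
  by (rule banach_space_on.norm_nonneg[OF fiber_banach_proj fiber_proj])

lemma openin_vnorm_less: "openin (bundle_space \<xi>) {x \<in> topspace (bundle_space \<xi>). vnorm \<xi> x < a}"
  using norm_usc by (simp add: upper_semicontinuous_def)

text \<open>The tubes around the fibre over \<open>t\<close> form a filter base. Along the filter
  they generate, base points tend to \<open>t\<close> and norms tend to 0, so
  \<open>small_norm_tendsto\<close> makes it converge to the origin over \<open>t\<close>; hence
  every open set around that origin contains a tube.\<close>

lemma origin_neighbourhood_contains_tube:
  assumes W: "openin (bundle_space \<xi>) W" "vzero \<xi> t \<in> W" and t: "t \<in> topspace (base \<xi>)"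
  obtains V e where "openin (base \<xi>) V" "t \<in> V" "e > 0"
    "\<And>x. \<lbrakk>x \<in> topspace (bundle_space \<xi>); proj \<xi> x \<in> V; vnorm \<xi> x < e\<rbrakk> \<Longrightarrow> x \<in> W"
proof -
  define B where "B = (\<lambda>(V, e). {x \<in> topspace (bundle_space \<xi>). proj \<xi> x \<in> V \<and> vnorm \<xi> x < e})"
  define I where "I = {(V, e). openin (base \<xi>) V \<and> t \<in> V \<and> e > (0::real)}"
  define F where "F = (INF i\<in>I. principal (B i))"
  have "I \<noteq> {}"
    using t by (auto simp: I_def intro!: exI[of _ "topspace (base \<xi>)"] exI[of _ 1])
  \<comment> \<open>The tubes are directed: intersecting the base sets and taking the smaller radius
    gives a tube inside both. This is what \<open>eventually_INF_base\<close> requires in order to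
    test membership in \<open>F\<close> on a single tube.\<close>
  moreover have "\<exists>k\<in>I. principal (B k) \<le> inf (principal (B i)) (principal (B j))"
    if "i \<in> I" "j \<in> I" for i j
    using that
    by (intro bexI[of _ "(fst i \<inter> fst j, min (snd i) (snd j))"]) (auto simp: I_def B_def)
  ultimately have ev: "eventually P F \<longleftrightarrow> (\<exists>i\<in>I. \<forall>x\<in>B i. P x)" for P
    unfolding F_def by (subst eventually_INF_base) (auto simp: eventually_principal)
  have "limitin (bundle_space \<xi>) (\<lambda>x. x) (vzero \<xi> t) F"
  proof (rule small_norm_tendsto)
    show "\<forall>\<^sub>F x in F. x \<in> topspace (bundle_space \<xi>)"
      using \<open>I \<noteq> {}\<close> by (auto simp: ev B_def)
    have "\<forall>\<^sub>F x in F. proj \<xi> x \<in> U" if "openin (base \<xi>) U" "t \<in> U" for U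
      unfolding ev using that by (intro bexI[of _ "(U, 1)"]) (auto simp: I_def B_def)
    then show "limitin (base \<xi>) (proj \<xi>) t F"
      using t by (simp add: limitin_def)
    \<comment> \<open>Nonnegativity of the norm turns the distance to 0 into the norm itself, so the
      tube of radius \<open>e\<close> over the whole base works.\<close>
    have "\<forall>\<^sub>F x in F. dist (vnorm \<xi> x) 0 < e" if "e > 0" for e
      unfolding ev using that t vnorm_nonneg
      by (intro bexI[of _ "(topspace (base \<xi>), e)"]) (auto simp: I_def B_def)
    then show "(vnorm \<xi> \<longlongrightarrow> 0) F"
      by (rule tendstoI)
  qed
  then have "\<forall>\<^sub>F x in F. x \<in> W"
    using W by (simp add: limitin_def)
  then show ?thesis
    unfolding ev I_def B_def using that by fastforce
qed

section \<open>Scalings, sections and translations\<close>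

lemma continuous_map_scale: "continuous_map (bundle_space \<xi>) (bundle_space \<xi>) (vscale \<xi> c)"
proof -
  have "continuous_map (bundle_space \<xi>) (prod_topology euclidean (bundle_space \<xi>)) (\<lambda>x. (c, x))"
    by (simp add: continuous_map_pairedI)
  from continuous_map_compose[OF this scale_continuous] show ?thesis
    by (simp add: o_def)
qed

lemma section_in_fiber:
  "\<lbrakk>bundle_section \<xi> f; t \<in> topspace (base \<xi>)\<rbrakk> \<Longrightarrow> f t \<in> fiber \<xi> t"
  using continuous_map_image_subset_topspace[of "base \<xi>" "bundle_space \<xi>" f]
  by (auto simp: bundle_section_def fiber_def)

lemma bundle_section_scale:
  assumes "bundle_section \<xi> f"
  shows "bundle_section \<xi> (\<lambda>t. vscale \<xi> c (f t))"
proof -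
  have "vscale \<xi> c (f t) \<in> fiber \<xi> t" if "t \<in> topspace (base \<xi>)" for t
    by (rule banach_space_on.scale_in[OF fiber_banach[OF that] section_in_fiber[OF assms that]])
  then show ?thesis
    using assms continuous_map_compose[OF _ continuous_map_scale[of c]]
    by (auto simp: bundle_section_def fiber_def o_def)
qed

text \<open>The points \<open>x\<close> and \<open>f (proj \<xi> x)\<close> lie over the same base
  point, so the translation factors through \<open>fiber_product \<xi>\<close>, on which addition is
  continuous.\<close>

lemma continuous_map_translate:
  assumes "bundle_section \<xi> f"
  shows "continuous_map (bundle_space \<xi>) (bundle_space \<xi>) (\<lambda>x. vadd \<xi> x (f (proj \<xi> x)))"
proof -
  have "continuous_map (bundle_space \<xi>) (bundle_space \<xi>) (\<lambda>x. f (proj \<xi> x))"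
    using continuous_map_compose[OF proj_continuous] assms
    by (auto simp: bundle_section_def o_def)
  then have "continuous_map (bundle_space \<xi>) (fiber_product \<xi>) (\<lambda>x. (x, f (proj \<xi> x)))"
    using assms proj_in
    by (auto simp: fiber_product_def continuous_map_in_subtopology continuous_map_pairedI
        bundle_section_def)
  from continuous_map_compose[OF this add_continuous] show ?thesis
    by (simp add: o_def)
qed

end

section \<open>Bundle maps over a common base\<close>

locale bundle_map =
  dom: banach_bundle \<xi> + cod: banach_bundle \<eta>
  for \<xi> :: "('k::real_normed_field, 'e, 't) bundle_data"
    and \<eta> :: "('k, 'f, 't) bundle_data" +
  fixes \<phi> :: "'e \<Rightarrow> 'f"
  assumes base_eq: "base \<xi> = base \<eta>"
    and map: "banach_bundle_map \<xi> \<eta> \<phi>"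
begin

lemma map_in_fiber: "\<lbrakk>t \<in> topspace (base \<eta>); x \<in> fiber \<xi> t\<rbrakk> \<Longrightarrow> \<phi> x \<in> fiber \<eta> t"
  using map unfolding banach_bundle_map_def base_eq by blast

lemma proj_map:
  assumes "x \<in> topspace (bundle_space \<xi>)"
  shows "proj \<eta> (\<phi> x) = proj \<xi> x"
proof -
  have "\<phi> x \<in> fiber \<eta> (proj \<xi> x)"
    using dom.proj_in[OF assms] dom.fiber_proj[OF assms] unfolding base_eq by (rule map_in_fiber)
  then show ?thesis
    by (simp add: fiber_def)
qed

lemma map_scale:
  "\<lbrakk>t \<in> topspace (base \<eta>); x \<in> fiber \<xi> t\<rbrakk> \<Longrightarrow> \<phi> (vscale \<xi> c x) = vscale \<eta> c (\<phi> x)"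
  using map unfolding banach_bundle_map_def base_eq by blast

lemma map_add:
  "\<lbrakk>t \<in> topspace (base \<eta>); x \<in> fiber \<xi> t; y \<in> fiber \<xi> t\<rbrakk>
     \<Longrightarrow> \<phi> (vadd \<xi> x y) = vadd \<eta> (\<phi> x) (\<phi> y)"
  using map unfolding banach_bundle_map_def base_eq by blast

lemma map_zero:
  assumes t: "t \<in> topspace (base \<eta>)"
  shows "\<phi> (vzero \<xi> t) = vzero \<eta> t"
proof -
  interpret D: banach_space_on "fiber \<xi> t" "vadd \<xi>" "vscale \<xi>" "vzero \<xi> t" "vnorm \<xi>"
    using t base_eq by (intro dom.fiber_banach) simp
  interpret C: banach_space_on "fiber \<eta> t" "vadd \<eta>" "vscale \<eta>" "vzero \<eta> t" "vnorm \<eta>"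
    using t by (rule cod.fiber_banach)
  show ?thesis
    using map_scale[OF t D.zero_in, of 0] map_in_fiber[OF t D.zero_in] D.zero_in
    by (simp add: D.scale_zero_left C.scale_zero_left)
qed

text \<open>Supplies sections of \<open>\<eta>\<close> along which to translate downstairs, matching
  given sections of \<open>\<xi>\<close>.\<close>

lemma bundle_section_map:
  assumes f: "bundle_section \<xi> f"
  shows "bundle_section \<eta> (\<lambda>t. \<phi> (f t))"
proof -
  have "continuous_map (base \<xi>) (bundle_space \<eta>) (\<phi> \<circ> f)"
    using f map by (auto simp: bundle_section_def banach_bundle_map_def intro: continuous_map_compose)
  moreover have "proj \<eta> (\<phi> (f t)) = t" if "t \<in> topspace (base \<eta>)" for t
    using map_in_fiber[OF that] dom.section_in_fiber[OF f] that base_eq by (simp add: fiber_def)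
  ultimately show ?thesis
    using base_eq by (simp add: bundle_section_def o_def)
qed

text \<open>The image of the open unit ball bundle contains a tube of some radius \<open>e\<close>.
  Every nonzero \<open>y\<close> over \<open>V\<close> can be rescaled into that tube, lifted to
  norm below 1, and scaled back; the constant depends only on \<open>e\<close>.\<close>

lemma open_map_imp_local_bound:
  assumes op: "open_map (bundle_space \<xi>) (bundle_space \<eta>) \<phi>"
    and t: "t \<in> topspace (base \<eta>)"
  obtains V m where "openin (base \<eta>) V" "t \<in> V" "m > 0"
    "\<And>y. \<lbrakk>y \<in> topspace (bundle_space \<eta>); proj \<eta> y \<in> V\<rbrakk> \<Longrightarrow>
       \<exists>x\<in>topspace (bundle_space \<xi>). \<phi> x = y \<and> vnorm \<xi> x \<le> m * vnorm \<eta> y"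
proof -
  define U where "U = {x \<in> topspace (bundle_space \<xi>). vnorm \<xi> x < 1}"
  interpret D: banach_space_on "fiber \<xi> t" "vadd \<xi>" "vscale \<xi>" "vzero \<xi> t" "vnorm \<xi>"
    using t base_eq by (intro dom.fiber_banach) simp
  have "openin (bundle_space \<eta>) (\<phi> ` U)"
    using op dom.openin_vnorm_less by (simp add: open_map_def U_def)
  moreover have "vzero \<xi> t \<in> U"
    using D.zero_in D.norm_eq_0[OF D.zero_in] by (simp add: U_def fiber_def)
  then have "vzero \<eta> t \<in> \<phi> ` U"
    using map_zero[OF t] by (metis imageI)
  ultimately obtain V e where V: "openin (base \<eta>) V" "t \<in> V" "e > 0"
    and tube: "\<And>y. \<lbrakk>y \<in> topspace (bundle_space \<eta>); proj \<eta> y \<in> V; vnorm \<eta> y < e\<rbrakk> \<Longrightarrow> y \<in> \<phi> ` U"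
    using cod.origin_neighbourhood_contains_tube t by metis
  show thesis
  \<comment> \<open>The tube has a strict radius, so \<open>y\<close> is rescaled to norm
    \<open>e / 2\<close>. Undoing this multiplies the norm of a lift by
    \<open>2 / e * vnorm \<eta> y\<close>.\<close>
  proof (rule that[of V "2 / e"])
    fix y assume y: "y \<in> topspace (bundle_space \<eta>)" "proj \<eta> y \<in> V"
    define s where "s = proj \<eta> y"
    have s: "s \<in> topspace (base \<eta>)" and ys: "y \<in> fiber \<eta> s"
      using y cod.proj_in cod.fiber_proj by (auto simp: s_def)
    interpret D: banach_space_on "fiber \<xi> s" "vadd \<xi>" "vscale \<xi>" "vzero \<xi> s" "vnorm \<xi>"
      using s base_eq by (intro dom.fiber_banach) simp
    interpret C: banach_space_on "fiber \<eta> s" "vadd \<eta>" "vscale \<eta>" "vzero \<eta> s" "vnorm \<eta>"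
      using s by (rule cod.fiber_banach)
    show "\<exists>x\<in>topspace (bundle_space \<xi>). \<phi> x = y \<and> vnorm \<xi> x \<le> 2 / e * vnorm \<eta> y"
    \<comment> \<open>Rescaling fails at norm 0, but there \<open>y\<close> is the origin over
      \<open>s\<close> and the origin of \<open>\<xi>\<close> over \<open>s\<close> is a lift of
      norm 0.\<close>
    proof (cases "vnorm \<eta> y = 0")
      case True
      then show ?thesis
        using map_zero[OF s] C.norm_eq_0[OF ys] D.zero_in D.norm_eq_0[OF D.zero_in]
        by (intro bexI[of _ "vzero \<xi> s"]) (auto simp: fiber_def)
    next
      case False
      then have pos: "vnorm \<eta> y > 0"
        using C.norm_nonneg[OF ys] by simp
      define r where "r = e / (2 * vnorm \<eta> y)"
      have r: "r > 0"
        using pos V by (simp add: r_def)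
      have "vscale \<eta> (of_real r) y \<in> fiber \<eta> s"
        by (rule C.scale_in[OF ys])
      moreover have "vnorm \<eta> (vscale \<eta> (of_real r) y) = e / 2"
        using pos r by (simp add: C.norm_scale[OF ys]) (simp add: r_def)
      ultimately have "vscale \<eta> (of_real r) y \<in> \<phi> ` U"
        using V y by (intro tube) (auto simp: fiber_def s_def)
      then obtain x where x: "x \<in> topspace (bundle_space \<xi>)" "vnorm \<xi> x < 1"
        "\<phi> x = vscale \<eta> (of_real r) y"
        by (auto simp: U_def)
      have xs: "x \<in> fiber \<xi> s"
        using x C.scale_in[OF ys, of "of_real r"] proj_map[of x] by (simp add: fiber_def)
      show ?thesis
      proof (intro bexI conjI)
        show "\<phi> (vscale \<xi> (of_real (1 / r)) x) = y"
          using r by (simp add: map_scale[OF s xs] x C.scale_scale ys C.scale_one)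
        have "vnorm \<xi> (vscale \<xi> (of_real (1 / r)) x) = 1 / r * vnorm \<xi> x"
          using r by (simp only: D.norm_scale[OF xs] norm_of_real) simp
        also have "\<dots> \<le> 1 / r * 1"
          using x r by (intro mult_left_mono) auto
        finally show "vnorm \<xi> (vscale \<xi> (of_real (1 / r)) x) \<le> 2 / e * vnorm \<eta> y"
          by (simp add: r_def)
        show "vscale \<xi> (of_real (1 / r)) x \<in> topspace (bundle_space \<xi>)"
          using D.scale_in[OF xs] by (simp add: fiber_def)
      qed
    qed
  qed (use V in auto)
qed

text \<open>A point \<open>y\<close> over \<open>s\<close> near \<open>\<phi> (f t)\<close> differs
  from \<open>\<phi> (f s)\<close> by a vector of small norm. The bound lifts this difference to a
  small vector over \<open>s\<close>, and adding \<open>f s\<close> gives a preimage of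
  \<open>y\<close> in \<open>U\<close>.\<close>

lemma local_bound_imp_image_neighbourhood:
  assumes f: "bundle_section \<xi> f" and t: "t \<in> topspace (base \<eta>)"
    and U: "openin (bundle_space \<xi>) U" "f t \<in> U"
    and V: "openin (base \<eta>) V" "t \<in> V" and m: "m > 0"
    and bound: "\<And>y. \<lbrakk>y \<in> topspace (bundle_space \<eta>); proj \<eta> y \<in> V\<rbrakk> \<Longrightarrow>
       \<exists>x\<in>topspace (bundle_space \<xi>). \<phi> x = y \<and> vnorm \<xi> x \<le> m * vnorm \<eta> y"
  obtains N where "openin (bundle_space \<eta>) N" "\<phi> (f t) \<in> N" "N \<subseteq> \<phi> ` U"
proof -
  \<comment> \<open>\<open>h\<close> adds the section \<open>f\<close> upstairs and \<open>g\<close>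
    subtracts its image downstairs, so that \<open>\<phi> (h x) = y\<close> whenever
    \<open>\<phi> x = g y\<close>.\<close>
  define h where "h = (\<lambda>x. vadd \<xi> x (f (proj \<xi> x)))"
  define k where "k = (\<lambda>s. vscale \<eta> (- 1) (\<phi> (f s)))"
  define g where "g = (\<lambda>y. vadd \<eta> y (k (proj \<eta> y)))"
  have sec_k: "bundle_section \<eta> k"
    unfolding k_def by (intro cod.bundle_section_scale bundle_section_map f)
  have cont_g: "continuous_map (bundle_space \<eta>) (bundle_space \<eta>) g"
    unfolding g_def by (rule cod.continuous_map_translate[OF sec_k])
  interpret D: banach_space_on "fiber \<xi> t" "vadd \<xi>" "vscale \<xi>" "vzero \<xi> t" "vnorm \<xi>"
    using t base_eq by (intro dom.fiber_banach) simp
  interpret C: banach_space_on "fiber \<eta> t" "vadd \<eta>" "vscale \<eta>" "vzero \<eta> t" "vnorm \<eta>"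
    using t by (rule cod.fiber_banach)
  have ft: "f t \<in> fiber \<xi> t"
    using dom.section_in_fiber[OF f] t base_eq by simp
  \<comment> \<open>\<open>h\<close> sends the origin over \<open>t\<close> to \<open>f t\<close>,
    so \<open>W\<close> is an open neighbourhood of that origin and contains a tube.\<close>
  define W where "W = {x \<in> topspace (bundle_space \<xi>). h x \<in> U}"
  have "openin (bundle_space \<xi>) W"
    unfolding W_def h_def by (rule openin_continuous_map_preimage[OF dom.continuous_map_translate[OF f] U(1)])
  moreover have "vzero \<xi> t \<in> W"
    using D.zero_in D.add_zero[OF ft] D.add_commute[OF D.zero_in ft] U(2)
    by (simp add: W_def h_def fiber_def)
  ultimately obtain V0 e where V0: "openin (base \<eta>) V0" "t \<in> V0" "e > 0"
    and tube: "\<And>x. \<lbrakk>x \<in> topspace (bundle_space \<xi>); proj \<xi> x \<in> V0; vnorm \<xi> x < e\<rbrakk> \<Longrightarrow> x \<in> W"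
    using dom.origin_neighbourhood_contains_tube t base_eq by metis
  \<comment> \<open>With radius \<open>e / m\<close>, a lift of \<open>g y\<close> of norm at most
    \<open>m\<close> times that of \<open>g y\<close> has norm below \<open>e\<close>, hence lies in
    the tube inside \<open>W\<close>. Upper semicontinuity of the norm and continuity of
    \<open>g\<close> make \<open>N\<close> open.\<close>
  define N where "N = {y \<in> topspace (bundle_space \<eta>). proj \<eta> y \<in> V0 \<inter> V} \<inter>
    {y \<in> topspace (bundle_space \<eta>). g y \<in> {z \<in> topspace (bundle_space \<eta>). vnorm \<eta> z < e / m}}"
  show thesis
  proof (rule that[of N])
    show "openin (bundle_space \<eta>) N"
      unfolding N_def using V V0
      by (intro openin_Int openin_continuous_map_preimage[OF cod.proj_continuous]
          openin_continuous_map_preimage[OF cont_g] cod.openin_vnorm_less)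
    have pf: "\<phi> (f t) \<in> fiber \<eta> t"
      by (rule map_in_fiber[OF t ft])
    then have "g (\<phi> (f t)) = vzero \<eta> t"
      using C.add_inverse by (simp add: g_def k_def fiber_def)
    then show "\<phi> (f t) \<in> N"
      using pf C.zero_in C.norm_eq_0[OF C.zero_in] V V0 m by (simp add: N_def fiber_def)
    show "N \<subseteq> \<phi> ` U"
    proof
      fix y assume y: "y \<in> N"
      define s where "s = proj \<eta> y"
      have s: "s \<in> topspace (base \<eta>)" "s \<in> V0" "s \<in> V" and ys: "y \<in> fiber \<eta> s"
        using y cod.proj_in by (auto simp: s_def N_def fiber_def)
      interpret D: banach_space_on "fiber \<xi> s" "vadd \<xi>" "vscale \<xi>" "vzero \<xi> s" "vnorm \<xi>"
        using s base_eq by (intro dom.fiber_banach) simp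
      interpret C: banach_space_on "fiber \<eta> s" "vadd \<eta>" "vscale \<eta>" "vzero \<eta> s" "vnorm \<eta>"
        using s by (intro cod.fiber_banach)
      have fs: "f s \<in> fiber \<xi> s"
        using dom.section_in_fiber[OF f] s base_eq by simp
      have ps: "\<phi> (f s) \<in> fiber \<eta> s" and ks: "k s \<in> fiber \<eta> s"
        using map_in_fiber[OF s(1) fs] cod.section_in_fiber[OF sec_k s(1)] by auto
      have gy: "g y = vadd \<eta> y (k s)" "g y \<in> fiber \<eta> s"
        using C.add_in[OF ys ks] by (simp_all add: g_def s_def)
      \<comment> \<open>The bound is applied to the difference \<open>g y\<close>, not to
        \<open>y\<close>: only the former is known to be small.\<close>
      obtain x where x: "x \<in> topspace (bundle_space \<xi>)" "\<phi> x = g y" "vnorm \<xi> x \<le> m * vnorm \<eta> (g y)"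
        using bound[of "g y"] gy(2) s by (auto simp: fiber_def)
      have xs: "x \<in> fiber \<xi> s"
        using x gy(2) proj_map[OF x(1)] by (simp add: fiber_def)
      have "vnorm \<eta> (g y) < e / m"
        using y by (simp add: N_def)
      then have "vnorm \<xi> x < e"
        using x(3) m by (simp add: field_simps)
      then have "h x \<in> U"
        using tube[OF x(1)] xs s by (simp add: fiber_def W_def)
      moreover have "\<phi> (h x) = y"
      proof -
        have "\<phi> (h x) = vadd \<eta> (vadd \<eta> y (k s)) (\<phi> (f s))"
          using xs map_add[OF s(1) xs fs] x(2) gy(1) by (simp add: h_def fiber_def)
        also have "\<dots> = vadd \<eta> y (vadd \<eta> (\<phi> (f s)) (k s))"
          by (simp add: C.add_assoc C.add_commute ys ks ps)
        also have "\<dots> = y"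
          using C.add_inverse[OF ps] C.add_zero[OF ys] by (simp add: k_def)
        finally show ?thesis .
      qed
      ultimately show "y \<in> \<phi> ` U"
        by (metis imageI)
    qed
  qed
qed

end

text \<open>Indexing covers by \<open>'t set set\<close> is no restriction, by
  \<open>open_cover_reindex\<close>.\<close>

theorem proposition3p3:
  fixes \<xi>1 :: "('k::real_normed_field, 'e, 't) bundle_data"
    and \<xi>2 :: "('k, 'f, 't) bundle_data"
    and \<phi> :: "'e \<Rightarrow> 'f"
  assumes "banach_bundle \<xi>1" and "full_bundle \<xi>1"
    and "banach_bundle \<xi>2"
    and "base \<xi>1 = base \<xi>2"
    and "banach_bundle_map \<xi>1 \<xi>2 \<phi>"
    and "\<phi> ` topspace (bundle_space \<xi>1) = topspace (bundle_space \<xi>2)"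
  shows "open_map (bundle_space \<xi>1) (bundle_space \<xi>2) \<phi> \<longleftrightarrow>
    (\<exists>(A :: 't set set) V (m :: 't set \<Rightarrow> real).
       open_cover (base \<xi>2) A V \<and>
       (\<forall>\<alpha> \<in> A. m \<alpha> > 0) \<and>
       (\<forall>\<alpha> \<in> A. \<forall>y \<in> topspace (bundle_space \<xi>2). proj \<xi>2 y \<in> V \<alpha> \<longrightarrow>
          (\<exists>x \<in> topspace (bundle_space \<xi>1). \<phi> x = y \<and> vnorm \<xi>1 x \<le> m \<alpha> * vnorm \<xi>2 y)))"
proof -
  interpret bundle_map \<xi>1 \<xi>2 \<phi>
    using assms by (intro bundle_map.intro bundle_map_axioms.intro)
  \<comment> \<open>Positivity and the lifting bound form one predicate, so that a single choice of
    \<open>m\<close> yields both; \<open>ball_conj_distrib\<close> separates them at the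
    end.\<close>
  define P where "P = (\<lambda>V m. m > 0 \<and>
    (\<forall>y \<in> topspace (bundle_space \<xi>2). proj \<xi>2 y \<in> V \<longrightarrow>
      (\<exists>x \<in> topspace (bundle_space \<xi>1). \<phi> x = y \<and> vnorm \<xi>1 x \<le> m * vnorm \<xi>2 y)))"
  have "open_map (bundle_space \<xi>1) (bundle_space \<xi>2) \<phi> \<longleftrightarrow>
    (\<exists>(A :: 't set set) V m. open_cover (base \<xi>2) A V \<and> (\<forall>\<alpha>\<in>A. P (V \<alpha>) (m \<alpha>)))"
    (is "?open \<longleftrightarrow> ?cover")
  proof
    assume ?open
    have "\<exists>V m. openin (base \<xi>2) V \<and> t \<in> V \<and> P V m" if "t \<in> topspace (base \<xi>2)" for t
      by (rule open_map_imp_local_bound[OF \<open>?open\<close> that]) (unfold P_def, blast)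
    then have "topspace (base \<xi>2) \<subseteq> \<Union> {V. openin (base \<xi>2) V \<and> (\<exists>m. P V m)}"
      by blast
    \<comment> \<open>The cover consists of all open sets that admit a bound, each indexed by
      itself; its constant is then picked by choice.\<close>
    then have "open_cover (base \<xi>2) {V. openin (base \<xi>2) V \<and> (\<exists>m. P V m)} (\<lambda>V. V)"
      unfolding open_cover_def using openin_subset[of "base \<xi>2"] by auto
    moreover have "\<forall>V\<in>{V. openin (base \<xi>2) V \<and> (\<exists>m. P V m)}. P V (SOME m. P V m)"
      by (blast intro: someI)
    ultimately show ?cover
      by (intro exI[of _ "{V. openin (base \<xi>2) V \<and> (\<exists>m. P V m)}"] exI[of _ "\<lambda>V. V"]
          exI[of _ "\<lambda>V. SOME m. P V m"] conjI)
  next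
    assume ?cover
    then obtain A :: "'t set set" and V m where cover: "open_cover (base \<xi>2) A V"
      and P: "\<And>\<alpha>. \<alpha> \<in> A \<Longrightarrow> P (V \<alpha>) (m \<alpha>)"
      by blast
    show ?open
      unfolding open_map_def
    proof (intro allI impI)
      fix U assume U: "openin (bundle_space \<xi>1) U"
      have "\<exists>N. openin (bundle_space \<xi>2) N \<and> \<phi> x \<in> N \<and> N \<subseteq> \<phi> ` U" if "x \<in> U" for x
      proof -
        have x: "x \<in> topspace (bundle_space \<xi>1)"
          using U that openin_subset by blast
        \<comment> \<open>Fullness provides the section through \<open>x\<close> along which to
          translate.\<close>
        then obtain f where f: "bundle_section \<xi>1 f" "f (proj \<xi>1 x) = x"
          using assms(2) by (auto simp: full_bundle_def)
        have t: "proj \<xi>1 x \<in> topspace (base \<xi>2)"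
          using dom.proj_in[OF x] base_eq by simp
        then obtain \<alpha> where \<alpha>: "\<alpha> \<in> A" "proj \<xi>1 x \<in> V \<alpha>" "openin (base \<xi>2) (V \<alpha>)"
          using cover by (auto simp: open_cover_def)
        show ?thesis
          by (rule local_bound_imp_image_neighbourhood[OF f(1) t U _ \<alpha>(3,2), of "m \<alpha>"])
            (use f P[OF \<alpha>(1)] that in \<open>auto simp: P_def\<close>)
      qed
      then show "openin (bundle_space \<xi>2) (\<phi> ` U)"
        by (subst openin_subopen) blast
    qed
  qed
  then show ?thesis
    unfolding P_def ball_conj_distrib .
qed

end
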